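(* Let $\mathcal{X}$ be a real Hilbert space, and let $\delta>0$, $\mu\ge0$ and $\nu\ge0$. Suppose that $g:[\delta,+\infty)\to\mathcal{X}$ and $a:[\delta,+\infty)\to[0,+\infty)$ are two continuously differentiable functions. If there exists a constant $C\ge0$ such that $$\left\|g(t)+e^{-\mu t^{\nu}}\int_{\delta}^{t}a(\tau)g(\tau)\,d\tau\right\|\le C,\qquad\forall t\ge\delta,$$ then $$\sup_{t\ge\delta}\|g(t)\|<+\infty.$$ *)

theory Defs
  imports "HOL-Analysis.Analysis"
begin

(* The derivative is taken within S, so it is one-sided at a boundary point of an
   interval S and depends only on f restricted to S.  The library's
   C1_differentiable_on instead uses the two-sided derivative at every point of S. *)
definition continuously_differentiable_on ::
    "(real \<Rightarrow> 'a::real_normed_vector) \<Rightarrow> real set \<Rightarrow> bool" where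
  "continuously_differentiable_on f S \<longleftrightarrow>
     (\<exists>f'. (\<forall>t\<in>S. (f has_vector_derivative f' t) (at t within S)) \<and> continuous_on S f')"

end

(* Write G for the integral of a g, w for the weight and A for the integral of a w.
   With the integrating factor exp A one has (exp A * G)' = exp A * a * (g + w G), whose norm is at
   most C exp A * a.  As w decreases, on [\<delta>, T] this is at most the derivative of
   (C / w T) exp A.  Hence w T * norm (G T) \<le> C, and norm (g T) \<le> 2 C. *)
theory Submission
  imports Defs
begin

lemma continuously_differentiable_on_imp_continuous_on:
  assumes "continuously_differentiable_on f S"
  shows "continuous_on S f"
  using assms unfolding continuously_differentiable_on_def continuous_on_eq_continuous_within
  by (meson has_vector_derivative_continuous)

text \<open>The weight enters only through its monotonicity and its sign, so it is kept abstract and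
  never differentiated. A compact interval is used because the comparison constant
  \<open>C / w T\<close> depends on the right endpoint, whereas the final bound \<open>C\<close>
  does not.\<close>

lemma weighted_integral_bound:
  fixes g :: "real \<Rightarrow> 'a::banach" and a w :: "real \<Rightarrow> real"
  assumes "\<delta> \<le> T"
    and g: "continuous_on {\<delta>..T} g"
    and a: "continuous_on {\<delta>..T} a" "\<And>t. t \<in> {\<delta>..T} \<Longrightarrow> a t \<ge> 0"
    and w: "continuous_on {\<delta>..T} w" "antimono_on {\<delta>..T} w" "w T > 0"
    and bound: "\<And>t. t \<in> {\<delta>..T} \<Longrightarrow>
      norm (g t + w t *\<^sub>R integral {\<delta>..t} (\<lambda>s. a s *\<^sub>R g s)) \<le> C"
  shows "w T * norm (integral {\<delta>..T} (\<lambda>s. a s *\<^sub>R g s)) \<le> C"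
proof (cases "\<delta> = T")
  case True
  \<comment> \<open>The mean value inequality used below needs a nondegenerate interval. Here the
    integral over a single point vanishes and only 0 \<le> \<open>C\<close> is left.\<close>
  then show ?thesis using order_trans[OF norm_ge_zero bound[of T]] by simp
next
  case False
  with \<open>\<delta> \<le> T\<close> have "\<delta> < T" by simp
  define G where "G t = integral {\<delta>..t} (\<lambda>s. a s *\<^sub>R g s)" for t
  define A where "A t = integral {\<delta>..t} (\<lambda>s. a s * w s)" for t
  have ag: "continuous_on {\<delta>..T} (\<lambda>s. a s *\<^sub>R g s)" and aw: "continuous_on {\<delta>..T} (\<lambda>s. a s * w s)"
    by (intro continuous_intros g a w)+
  have G': "(G has_vector_derivative a t *\<^sub>R g t) (at t within {\<delta>..T})" if "t \<in> {\<delta>..T}" for t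
    unfolding G_def using integral_has_vector_derivative[OF ag that] .
  have A': "(A has_real_derivative a t * w t) (at t within {\<delta>..T})" if "t \<in> {\<delta>..T}" for t
    unfolding A_def has_real_derivative_iff_has_vector_derivative
    using integral_has_vector_derivative[OF aw that] .
  have contG: "continuous_on {\<delta>..T} G" and contA: "continuous_on {\<delta>..T} A"
    using G' A' unfolding continuous_on_eq_continuous_within
    by (meson has_vector_derivative_continuous DERIV_continuous)+
  \<comment> \<open>The mean value inequality asks for two-sided derivatives at interior points and
    only continuity at the endpoints.\<close>
  have at: "at t within {\<delta>..T} = at t" if "\<delta> < t" "t < T" for t
    using that by (intro at_within_interior) auto
  have "C \<ge> 0" using order_trans[OF norm_ge_zero bound[of T]] \<open>\<delta> \<le> T\<close> by simp
  have "norm (exp (A T) *\<^sub>R G T - exp (A \<delta>) *\<^sub>R G \<delta>)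
      \<le> C / w T * exp (A T) - C / w T * exp (A \<delta>)"
  proof (rule differentiable_bound_general[OF \<open>\<delta> < T\<close>])
    fix t assume t: "\<delta> < t" "t < T"
    then have tT: "t \<in> {\<delta>..T}" by simp
    note G't = G'[OF tT, unfolded at[OF t]] and A't = A'[OF tT, unfolded at[OF t]]
    \<comment> \<open>The product rule gives two terms; factoring out \<open>exp (A t) * a t\<close>
      exposes exactly the combination controlled by \<open>bound\<close>.\<close>
    show "((\<lambda>t. exp (A t) *\<^sub>R G t) has_vector_derivative
        (exp (A t) * a t) *\<^sub>R (g t + w t *\<^sub>R G t)) (at t)"
      by (rule has_vector_derivative_eq_rhs
            [OF has_vector_derivative_scaleR[OF DERIV_fun_exp[OF A't] G't]])
        (simp add: algebra_simps)
    show "((\<lambda>t. C / w T * exp (A t)) has_vector_derivative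
        C / w T * (exp (A t) * (a t * w t))) (at t)"
      unfolding has_real_derivative_iff_has_vector_derivative[symmetric]
      by (intro DERIV_cmult DERIV_fun_exp A't)
    \<comment> \<open>The derivative of \<open>exp (A t)\<close> carries a factor \<open>w t\<close>
      that the norm estimate lacks; it is inserted as \<open>w t / w T\<close>, which is at least
      1.\<close>
    have "w T \<le> w t"
      using w(2) tT t \<open>\<delta> < T\<close> by (auto dest!: monotone_onD[of _ _ _ w t T])
    then have "1 \<le> w t / w T" using w(3) by simp
    then have "C * 1 \<le> C * (w t / w T)" using \<open>C \<ge> 0\<close> by (intro mult_left_mono)
    then have "norm (g t + w t *\<^sub>R G t) \<le> C * (w t / w T)"
      using bound[OF tT] by (simp add: G_def)
    then have "exp (A t) * a t * norm (g t + w t *\<^sub>R G t) \<le> exp (A t) * a t * (C * (w t / w T))"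
      using a(2)[OF tT] by (intro mult_left_mono) auto
    then show "norm ((exp (A t) * a t) *\<^sub>R (g t + w t *\<^sub>R G t))
        \<le> C / w T * (exp (A t) * (a t * w t))"
      using a(2)[OF tT] by (simp add: abs_mult mult_ac)
  qed (intro continuous_intros contG contA)+
  also have "\<dots> \<le> C / w T * exp (A T)"
    using \<open>C \<ge> 0\<close> w(3) by simp
  \<comment> \<open>The initial term disappears because \<open>G \<delta>\<close> is an integral
    over a point. The common factor \<open>exp (A T)\<close> then cancels, so the growth of
    \<open>A\<close> does not affect the bound.\<close>
  finally have "exp (A T) * norm (G T) \<le> exp (A T) * (C / w T)"
    by (simp add: G_def mult.commute)
  then have "norm (G T) \<le> C / w T"
    by (rule mult_left_le_imp_le) simp
  then show ?thesis using w(3) by (simp add: G_def field_simps)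
qed

theorem lemma2p3:
  fixes \<delta> \<mu> \<nu> :: real
    and g :: "real \<Rightarrow> 'x::{real_inner, banach}"
    and a :: "real \<Rightarrow> real"
  assumes "\<delta> > 0" and "\<mu> \<ge> 0" and "\<nu> \<ge> 0"
    and "continuously_differentiable_on g {\<delta>..}"
    and "continuously_differentiable_on a {\<delta>..}"
    and "\<forall>t\<ge>\<delta>. a t \<ge> 0"
    and "\<exists>C\<ge>0. \<forall>t\<ge>\<delta>.
           norm (g t + exp (- \<mu> * t powr \<nu>) *\<^sub>R integral {\<delta>..t} (\<lambda>\<tau>. a \<tau> *\<^sub>R g \<tau>)) \<le> C"
  shows "(SUP t\<in>{\<delta>..}. ereal (norm (g t))) < \<infinity>"
proof -
  define w where "w t = exp (- \<mu> * t powr \<nu>)" for t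
  define G where "G t = integral {\<delta>..t} (\<lambda>\<tau>. a \<tau> *\<^sub>R g \<tau>)" for t
  obtain C where C: "\<And>t. t \<ge> \<delta> \<Longrightarrow> norm (g t + w t *\<^sub>R G t) \<le> C"
    using assms(7) unfolding w_def G_def by blast
  have "norm (g T) \<le> 2 * C" if "T \<ge> \<delta>" for T
  proof -
    have "w T * norm (G T) \<le> C"
      unfolding G_def
    proof (rule weighted_integral_bound[OF that])
      show "continuous_on {\<delta>..T} g" "continuous_on {\<delta>..T} a"
        using assms(4,5) by (auto intro: continuous_on_subset
            dest!: continuously_differentiable_on_imp_continuous_on)
      \<comment> \<open>Since \<delta> > 0, the base of \<open>powr\<close> stays away from
        0.\<close>
      show "continuous_on {\<delta>..T} w"
        unfolding w_def using assms(1) by (intro continuous_intros) auto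
      show "antimono_on {\<delta>..T} w"
        unfolding w_def using assms(1-3) by (auto intro!: monotone_onI mult_left_mono powr_mono2)
    qed (use assms(6) C in \<open>auto simp: w_def G_def\<close>)
    \<comment> \<open>One \<open>C\<close> comes from the hypothesis at \<open>T\<close>, the other
      from removing the weighted integral.\<close>
    moreover have "norm (g T) \<le> norm (g T + w T *\<^sub>R G T) + norm (w T *\<^sub>R G T)"
      using norm_triangle_ineq4[of "g T + w T *\<^sub>R G T" "w T *\<^sub>R G T"] by simp
    moreover have "norm (w T *\<^sub>R G T) = w T * norm (G T)"
      by (simp add: w_def)
    ultimately show ?thesis using C[OF that] by linarith
  qed
  \<comment> \<open>\<open>C\<close> was fixed before \<open>T\<close>, so the bound is uniform and
    passes to the supremum.\<close>
  then have "(SUP t\<in>{\<delta>..}. ereal (norm (g t))) \<le> ereal (2 * C)"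
    by (intro SUP_least) auto
  then show ?thesis
    by (rule order.strict_trans1) simp
qed

end
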